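(* Let $(t_m,i_m,J_m)$, $m\ge1$, be a sequence of observations from a multivariate point process of multicast interactions in which the intensity of interaction between sender $i$ and receiver set $J$ is $$\lambda_t(i,J)=\bar\lambda_t(i;|J|)\,\exp\Big\{\sum_{j\in J}\beta_0^{T}x_t(i,j)\Big\}\prod_{j\in J}1\{j\in\mathcal J_t(i)\}.$$ Assume that $\sup_{t,i,j}\|x_t(i,j)\|$ and $\sup_m|J_m|$ are bounded in probability. Define $$\log \mathit{PL}_t(\beta)=\sum_{t_m\le t}\Big\{\sum_{j\in J_m}\beta^{T}x_{t_m}(i_m,j)-\log\Big[\sum_{J\subseteq\mathcal J_{t_m}(i_m),\,|J|=|J_m|}\exp\Big\{\sum_{j\in J}\beta^{T}x_{t_m}(i_m,j)\Big\}\Big]\Big\},$$ $$\log\widetilde{\mathit{PL}}_t(\beta)=\sum_{t_m\le t}\Big\{\sum_{j\in J_m}\beta^{T}x_{t_m}(i_m,j)-|J_m|\log\Big[\sum_{j\in\mathcal J_{t_m}(i_m)}\exp\{\beta^{T}x_{t_m}(i_m,j)\}\Big]\Big\},$$ and $$G_n=\sum_{t_m\le t_n}\frac{1\{|J_m|>1\}}{|\mathcal J_{t_m}(i_m)|}.$$ Then for $\beta$ in a neighborhood of $\beta_0$, $$\Big\|\nabla[\log \mathit{PL}_{t_n}(\beta)]-\nabla[\log\widetilde{\mathit{PL}}_{t_n}(\beta)]\Big\|=\mathcal O_P(G_n)$$ and $$\Big\|\nabla^2[\log \mathit{PL}_{t_n}(\beta)]-\nabla^2[\log\widetilde{\mathit{PL}}_{t_n}(\beta)]\Big\|=\mathcal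 O_P(G_n).$$
   Context: $\mathcal I$ is a set of senders and $\mathcal J$ a set of receivers. An observation $(t,i,J)$ means that at time $t$ sender $i\in\mathcal I$ interacted with the receiver set $J\subseteq\mathcal J$; $t_1,t_2,\dots$ are the successive interaction times. For each $i$ and each positive integer $L$, $\bar\lambda_t(i;L)$ is a non-negative predictable process (baseline $L$-receiver intensity); $\mathcal J_t(i)$ is a predictable finite subset of $\mathcal J$; $x_t(i,j)$ is a predictable locally bounded process with values in $\mathbb{R}^p$; $\beta_0\in\mathbb{R}^p$. $|J|$ denotes cardinality. $\|\cdot\|$ is the Euclidean norm for vectors and the spectral norm for matrices. $A_n=\mathcal O_P(G_n)$ means that for every $\varepsilon>0$ there is a constant $C$ with $\mathbb P\{A_n>C\,G_n\}\le\varepsilon$ for all sufficiently large $n$. *)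

theory Defs
  imports "HOL-Probability.Probability"
begin

section \<open>Stochastic order\<close>

text \<open>
  The outer measure agrees with the measure on measurable events. It is used because \<open>measure\<close>
  is 0 on non-measurable sets, so that suprema over uncountable index sets would otherwise
  require separate measurability side conditions.
\<close>

definition big_O_P :: "'w measure \<Rightarrow> (nat \<Rightarrow> 'w \<Rightarrow> ereal) \<Rightarrow> (nat \<Rightarrow> 'w \<Rightarrow> real) \<Rightarrow> bool" where
  "big_O_P M A G \<longleftrightarrow>
    (\<forall>\<epsilon>>0. \<exists>C::real. \<forall>\<^sub>F n in sequentially.
       outer_measure_of M {\<omega> \<in> space M. A n \<omega> > ereal (C * G n \<omega>)} \<le> ennreal \<epsilon>)"

definition bounded_in_prob :: "'w measure \<Rightarrow> ('w \<Rightarrow> ereal) \<Rightarrow> bool" where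
  "bounded_in_prob M X \<longleftrightarrow> big_O_P M (\<lambda>n. X) (\<lambda>n \<omega>. 1)"


section \<open>Predictable processes and intensities\<close>

text \<open>
  Time is \<open>{0..}\<close>. Filtrations are indexed by all reals only to match the library's
  \<open>filtration\<close> and \<open>stopping_time\<close>; the part of a filtration at negative times
  can be taken to be constant.
\<close>

definition predictable_sigma :: "'w measure \<Rightarrow> (real \<Rightarrow> 'w measure) \<Rightarrow> (real \<times> 'w) measure" where
  "predictable_sigma M F =
     sigma ({0..} \<times> space M)
       ({{0} \<times> A |A. A \<in> sets (F 0)} \<union>
        {{s<..t} \<times> A |s t A. 0 \<le> s \<and> s < t \<and> A \<in> sets (F s)})"

definition predictable ::
  "'w measure \<Rightarrow> (real \<Rightarrow> 'w measure) \<Rightarrow> (real \<Rightarrow> 'w \<Rightarrow> 'b::topological_space) \<Rightarrow> bool" where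
  "predictable M F X \<longleftrightarrow> (\<lambda>(t, \<omega>). X t \<omega>) \<in> borel_measurable (predictable_sigma M F)"

text \<open>
  Local boundedness: \<open>X\<close> stopped at \<open>\<tau> k\<close>, on the event \<open>\<tau> k > 0\<close>, is bounded by a constant.
  Finite-valued \<open>\<tau> k\<close> suffice, since one may pass to \<open>min (\<tau> k) k\<close>.
\<close>

definition locally_bounded_process ::
  "'w measure \<Rightarrow> (real \<Rightarrow> 'w measure) \<Rightarrow> (real \<Rightarrow> 'w \<Rightarrow> 'b::real_normed_vector) \<Rightarrow> bool" where
  "locally_bounded_process M F X \<longleftrightarrow>
    (\<exists>\<tau> :: nat \<Rightarrow> 'w \<Rightarrow> real.
       (\<forall>k. stopping_time F (\<tau> k)) \<and>
       (\<forall>k. \<forall>\<omega>\<in>space M. 0 \<le> \<tau> k \<omega>) \<and>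
       (AE \<omega> in M. incseq (\<lambda>k. \<tau> k \<omega>) \<and> filterlim (\<lambda>k. \<tau> k \<omega>) at_top sequentially) \<and>
       (\<forall>k. \<exists>C. \<forall>\<omega>\<in>space M. 0 < \<tau> k \<omega> \<longrightarrow> (\<forall>t\<in>{0..\<tau> k \<omega>}. norm (X t \<omega>) \<le> C)))"

text \<open>
  \<open>P \<omega>\<close> is the random set of jump times of a simple counting process \<open>N\<close>, so the integral
  against \<open>count_space (P \<omega>)\<close> is the Stieltjes integral against \<open>N\<close>. The defining property
  of the intensity is that the expected integrals of any non-negative predictable \<open>C\<close> against
  \<open>dN\<close> and against \<open>\<lambda>\<^sub>s ds\<close> coincide.
\<close>

definition has_intensity ::
  "'w measure \<Rightarrow> (real \<Rightarrow> 'w measure) \<Rightarrow> ('w \<Rightarrow> real set) \<Rightarrow> (real \<Rightarrow> 'w \<Rightarrow> real) \<Rightarrow> bool" where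
  "has_intensity M F P lam \<longleftrightarrow>
     predictable M F lam \<and>
     (\<forall>t\<ge>0. \<forall>\<omega>\<in>space M. 0 \<le> lam t \<omega>) \<and>
     (AE \<omega> in M. \<forall>t\<ge>0. (\<integral>\<^sup>+ s\<in>{0<..t}. ennreal (lam s \<omega>) \<partial>lborel) < \<infinity>) \<and>
     (\<forall>C :: real \<Rightarrow> 'w \<Rightarrow> ennreal. predictable M F C \<longrightarrow>
        (\<integral>\<^sup>+ \<omega>. (\<integral>\<^sup>+ s. C s \<omega> \<partial>count_space (P \<omega>)) \<partial>M) =
        (\<integral>\<^sup>+ \<omega>. (\<integral>\<^sup>+ s\<in>{0<..}. C s \<omega> * ennreal (lam s \<omega>) \<partial>lborel) \<partial>M))"


section \<open>Multicast interactions\<close>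

text \<open>
  The types \<open>'i\<close> and \<open>'j\<close> are the sets of senders and receivers. Observation \<open>m \<ge> 1\<close> is
  \<open>(T m \<omega>, S m \<omega>, R m \<omega>)\<close>: time, sender, receiver set. The index \<open>m = 0\<close> is not used.
\<close>

definition multicast_point_process ::
  "'w measure \<Rightarrow> (real \<Rightarrow> 'w measure) \<Rightarrow>
   (nat \<Rightarrow> 'w \<Rightarrow> real) \<Rightarrow> (nat \<Rightarrow> 'w \<Rightarrow> 'i) \<Rightarrow> (nat \<Rightarrow> 'w \<Rightarrow> 'j set) \<Rightarrow> bool" where
  "multicast_point_process M F T S R \<longleftrightarrow>
     (\<forall>m\<ge>1. stopping_time F (T m)) \<and>
     (\<forall>m\<ge>1. \<forall>t\<ge>0. \<forall>i J. {\<omega> \<in> space M. T m \<omega> \<le> t \<and> S m \<omega> = i \<and> R m \<omega> = J} \<in> sets (F t)) \<and>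
     (AE \<omega> in M. 0 < T 1 \<omega> \<and> (\<forall>m\<ge>1. T m \<omega> < T (Suc m) \<omega>) \<and>
                 filterlim (\<lambda>m. T m \<omega>) at_top sequentially) \<and>
     (AE \<omega> in M. \<forall>m\<ge>1. finite (R m \<omega>) \<and> R m \<omega> \<noteq> {})"

definition interaction_times ::
  "(nat \<Rightarrow> 'w \<Rightarrow> real) \<Rightarrow> (nat \<Rightarrow> 'w \<Rightarrow> 'i) \<Rightarrow> (nat \<Rightarrow> 'w \<Rightarrow> 'j set) \<Rightarrow>
   'i \<Rightarrow> 'j set \<Rightarrow> 'w \<Rightarrow> real set" where
  "interaction_times T S R i J \<omega> = {T m \<omega> |m. 1 \<le> m \<and> S m \<omega> = i \<and> R m \<omega> = J}"

definition multicast_intensity ::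
  "(real \<Rightarrow> 'w \<Rightarrow> 'i \<Rightarrow> nat \<Rightarrow> real) \<Rightarrow> (real \<Rightarrow> 'w \<Rightarrow> 'i \<Rightarrow> 'j set) \<Rightarrow>
   (real \<Rightarrow> 'w \<Rightarrow> 'i \<Rightarrow> 'j \<Rightarrow> real ^ 'p) \<Rightarrow> real ^ 'p \<Rightarrow> 'i \<Rightarrow> 'j set \<Rightarrow> real \<Rightarrow> 'w \<Rightarrow> real" where
  "multicast_intensity lbar A x \<beta>\<^sub>0 i J t \<omega> =
     lbar t \<omega> i (card J) * exp (\<Sum>j\<in>J. \<beta>\<^sub>0 \<bullet> x t \<omega> i j) * (\<Prod>j\<in>J. of_bool (j \<in> A t \<omega> i))"

definition log_PL ::
  "(nat \<Rightarrow> 'w \<Rightarrow> real) \<Rightarrow> (nat \<Rightarrow> 'w \<Rightarrow> 'i) \<Rightarrow> (nat \<Rightarrow> 'w \<Rightarrow> 'j set) \<Rightarrow>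
   (real \<Rightarrow> 'w \<Rightarrow> 'i \<Rightarrow> 'j set) \<Rightarrow> (real \<Rightarrow> 'w \<Rightarrow> 'i \<Rightarrow> 'j \<Rightarrow> real ^ 'p) \<Rightarrow>
   real \<Rightarrow> 'w \<Rightarrow> real ^ 'p \<Rightarrow> real" where
  "log_PL T S R A x t \<omega> \<beta> =
     (\<Sum>m | 1 \<le> m \<and> T m \<omega> \<le> t.
        (\<Sum>j\<in>R m \<omega>. \<beta> \<bullet> x (T m \<omega>) \<omega> (S m \<omega>) j) -
        ln (\<Sum>J | J \<subseteq> A (T m \<omega>) \<omega> (S m \<omega>) \<and> card J = card (R m \<omega>).
              exp (\<Sum>j\<in>J. \<beta> \<bullet> x (T m \<omega>) \<omega> (S m \<omega>) j)))"

definition log_PL_approx ::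
  "(nat \<Rightarrow> 'w \<Rightarrow> real) \<Rightarrow> (nat \<Rightarrow> 'w \<Rightarrow> 'i) \<Rightarrow> (nat \<Rightarrow> 'w \<Rightarrow> 'j set) \<Rightarrow>
   (real \<Rightarrow> 'w \<Rightarrow> 'i \<Rightarrow> 'j set) \<Rightarrow> (real \<Rightarrow> 'w \<Rightarrow> 'i \<Rightarrow> 'j \<Rightarrow> real ^ 'p) \<Rightarrow>
   real \<Rightarrow> 'w \<Rightarrow> real ^ 'p \<Rightarrow> real" where
  "log_PL_approx T S R A x t \<omega> \<beta> =
     (\<Sum>m | 1 \<le> m \<and> T m \<omega> \<le> t.
        (\<Sum>j\<in>R m \<omega>. \<beta> \<bullet> x (T m \<omega>) \<omega> (S m \<omega>) j) -
        real (card (R m \<omega>)) *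
          ln (\<Sum>j\<in>A (T m \<omega>) \<omega> (S m \<omega>). exp (\<beta> \<bullet> x (T m \<omega>) \<omega> (S m \<omega>) j)))"

definition growth ::
  "(nat \<Rightarrow> 'w \<Rightarrow> real) \<Rightarrow> (nat \<Rightarrow> 'w \<Rightarrow> 'i) \<Rightarrow> (nat \<Rightarrow> 'w \<Rightarrow> 'j set) \<Rightarrow>
   (real \<Rightarrow> 'w \<Rightarrow> 'i \<Rightarrow> 'j set) \<Rightarrow> nat \<Rightarrow> 'w \<Rightarrow> real" where
  "growth T S R A n \<omega> =
     (\<Sum>m | 1 \<le> m \<and> T m \<omega> \<le> T n \<omega>.
        of_bool (card (R m \<omega>) > 1) / real (card (A (T m \<omega>) \<omega> (S m \<omega>))))"


section \<open>Gradient, Hessian, spectral norm\<close>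

definition grad :: "(real ^ 'p \<Rightarrow> real) \<Rightarrow> real ^ 'p \<Rightarrow> real ^ 'p" where
  "grad f \<beta> = (\<chi> k. frechet_derivative f (at \<beta>) (axis k 1))"

definition hessian :: "(real ^ 'p \<Rightarrow> real) \<Rightarrow> real ^ 'p \<Rightarrow> real ^ 'p ^ 'p" where
  "hessian f \<beta> = jacobian (grad f) (at \<beta>)"

text \<open>\<open>norm\<close> on \<open>real ^ 'n ^ 'm\<close> is the Frobenius norm, not the spectral norm.\<close>

definition spectral_norm :: "real ^ 'n ^ 'm \<Rightarrow> real" where
  "spectral_norm B = onorm (\<lambda>v. B *v v)"

end

theory Submission
  imports Defs "HOL-Combinatorics.Multiset_Permutations"
begin

text \<open>
  The estimate holds pathwise. Up to a constant, the contribution of one observation to the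
  partial likelihood is the log-sum-exp over \<open>L\<close>-tuples of distinct receivers, and its
  contribution to the approximation is the log-sum-exp over all \<open>L\<close>-tuples. Gradient and Hessian of
  a log-sum-exp are the mean and covariance of a Gibbs measure. The first Gibbs measure is
  the second one (\<open>L\<close> independent draws) conditioned on having no repetition, so
  expectations of a function bounded by \<open>H\<close> differ by at most \<open>2 H q\<close>, where \<open>q\<close> is the probability
  of a repetition. As all weights lie in \<open>[exp (- b), exp b]\<close>, we have \<open>q \<le> L\<^sup>2 exp (2 b) / N\<close> for
  \<open>N\<close> available receivers, and \<open>q = 0\<close> if \<open>L \<le> 1\<close>.
\<close>

section \<open>Weighted means\<close>

text \<open>The weights are not normalised, so that for positive \<open>w\<close> the mean over a
  subset with the same \<open>w\<close> is the conditional mean given that subset.\<close>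

definition wmean :: "'a set \<Rightarrow> ('a \<Rightarrow> real) \<Rightarrow> ('a \<Rightarrow> 'v::real_vector) \<Rightarrow> 'v" where
  "wmean I w h = (\<Sum>i\<in>I. w i *\<^sub>R h i) /\<^sub>R sum w I"

lemma wmean_empty [simp]: "wmean {} w h = 0"
  by (simp add: wmean_def)

lemma norm_weighted_sum_le:
  fixes h :: "'a \<Rightarrow> 'v::real_normed_vector"
  assumes "\<And>i. i \<in> I \<Longrightarrow> 0 \<le> w i" "\<And>i. i \<in> I \<Longrightarrow> norm (h i) \<le> H"
  shows "norm (\<Sum>i\<in>I. w i *\<^sub>R h i) \<le> sum w I * H"
  unfolding sum_distrib_right
  by (rule sum_norm_le) (use assms in \<open>simp add: mult_left_mono\<close>)

lemma norm_wmean_le: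
  fixes h :: "'a \<Rightarrow> 'v::real_normed_vector"
  assumes "\<And>i. i \<in> I \<Longrightarrow> 0 \<le> w i" "\<And>i. i \<in> I \<Longrightarrow> norm (h i) \<le> H" "0 \<le> H"
  shows "norm (wmean I w h) \<le> H"
proof (cases "sum w I = 0")
  case False
  have pos: "sum w I > 0"
    using False sum_nonneg[of I w] assms(1) by fastforce
  have "norm (\<Sum>i\<in>I. w i *\<^sub>R h i) \<le> sum w I * H"
    using assms by (intro norm_weighted_sum_le) auto
  then show ?thesis
    using pos by (simp add: wmean_def field_simps)
qed (simp add: wmean_def assms)

text \<open>
  \<open>D = {}\<close> is allowed: both \<open>wmean {} w h\<close> and \<open>ln 0\<close> are 0 in HOL, and then \<open>q \<ge> 1\<close>. This covers
  observations with fewer available receivers than \<open>L\<close>, for which the sum over receiver sets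
  is empty.
\<close>

lemma norm_wmean_diff_le:
  fixes h :: "'a \<Rightarrow> 'v::real_normed_vector"
  assumes fin: "finite I" and sub: "D \<subseteq> I"
    and w: "\<And>i. i \<in> I \<Longrightarrow> 0 < w i"
    and h: "\<And>i. i \<in> I \<Longrightarrow> norm (h i) \<le> H" and H: "0 \<le> H"
    and q: "sum w I - sum w D \<le> q * sum w I" "0 \<le> q"
  shows "norm (wmean D w h - wmean I w h) \<le> 2 * H * q"
proof (cases "I = {}")
  case True
  then show ?thesis using sub H q by simp
next
  case False
  define W where "W = sum w I"
  have W: "W > 0" using False fin w by (simp add: W_def sum_pos)
  have WD: "sum w D = W - sum w (I - D)"
    using sum.subset_diff[OF sub fin, of w] by (simp add: W_def)
  have D: "(\<Sum>i\<in>D. w i *\<^sub>R h i) = sum w D *\<^sub>R wmean D w h"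
  proof (cases "D = {}")
    case False
    then have "sum w D > 0" using sub w fin by (intro sum_pos) (auto intro: finite_subset)
    then show ?thesis by (simp add: wmean_def)
  qed simp
  \<comment> \<open>Splitting \<open>I\<close> into \<open>D\<close> and \<open>I - D\<close> leaves
    two terms that carry only the weight of \<open>I - D\<close>. Each has norm at most that weight
    times \<open>H\<close>, whence the factor 2.\<close>
  have "W *\<^sub>R (wmean D w h - wmean I w h)
      = sum w (I - D) *\<^sub>R wmean D w h - (\<Sum>i\<in>I - D. w i *\<^sub>R h i)"
    using W sum.subset_diff[OF sub fin, of "\<lambda>i. w i *\<^sub>R h i"] D WD
    by (simp add: wmean_def[of I] W_def[symmetric] algebra_simps)
  then have "W * norm (wmean D w h - wmean I w h)
      = norm (sum w (I - D) *\<^sub>R wmean D w h - (\<Sum>i\<in>I - D. w i *\<^sub>R h i))"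
    using W by (metis norm_scaleR abs_of_pos)
  also have "\<dots> \<le> norm (sum w (I - D) *\<^sub>R wmean D w h) + norm (\<Sum>i\<in>I - D. w i *\<^sub>R h i)"
    by (rule norm_triangle_ineq4)
  also have "\<dots> \<le> sum w (I - D) * H + sum w (I - D) * H"
  proof (rule add_mono)
    have "0 \<le> sum w (I - D)" using w by (intro sum_nonneg) (auto intro: less_imp_le)
    moreover have "norm (wmean D w h) \<le> H"
      using sub w h H by (intro norm_wmean_le) (auto intro: less_imp_le)
    ultimately show "norm (sum w (I - D) *\<^sub>R wmean D w h) \<le> sum w (I - D) * H"
      by (simp add: mult_left_mono)
    show "norm (\<Sum>i\<in>I - D. w i *\<^sub>R h i) \<le> sum w (I - D) * H"
      using w h by (intro norm_weighted_sum_le) (auto intro: less_imp_le)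
  qed
  also have "\<dots> = 2 * H * (W - sum w D)" using WD by simp
  also have "\<dots> \<le> 2 * H * (q * W)"
    using q H by (intro mult_left_mono) (auto simp: W_def)
  finally have "W * norm (wmean D w h - wmean I w h) \<le> W * (2 * H * q)"
    by (simp add: mult_ac)
  then show ?thesis using W by simp
qed

section \<open>Log-sum-exp functions\<close>

abbreviation gibbs_mean :: "'a set \<Rightarrow> ('a \<Rightarrow> 'v::real_inner) \<Rightarrow> 'v \<Rightarrow> 'v" where
  "gibbs_mean I y \<beta> \<equiv> wmean I (\<lambda>i. exp (\<beta> \<bullet> y i)) y"

text \<open>The covariance of \<open>y\<close> under the Gibbs measure, applied to \<open>v\<close>.
  Written as a function of the direction, it can serve directly as a Frechet derivative, and the
  estimates concern vectors instead of matrices.\<close>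

definition gibbs_cov :: "'a set \<Rightarrow> ('a \<Rightarrow> 'v::real_inner) \<Rightarrow> 'v \<Rightarrow> 'v \<Rightarrow> 'v" where
  "gibbs_cov I y \<beta> v = wmean I (\<lambda>i. exp (\<beta> \<bullet> y i)) (\<lambda>i. (v \<bullet> y i) *\<^sub>R y i)
     - (v \<bullet> gibbs_mean I y \<beta>) *\<^sub>R gibbs_mean I y \<beta>"

text \<open>The logarithm divides the derivative of the partition sum by that sum, which is a Gibbs
  mean. For empty \<open>I\<close> the function is \<open>ln 0 = 0\<close> throughout and the mean
  is 0.\<close>

lemma has_derivative_ln_sum_exp:
  fixes y :: "'a \<Rightarrow> 'v::real_inner"
  assumes "finite I"
  shows "((\<lambda>\<beta>. ln (\<Sum>i\<in>I. exp (\<beta> \<bullet> y i))) has_derivative (\<lambda>v. v \<bullet> gibbs_mean I y \<beta>)) (at \<beta>)"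
proof (cases "I = {}")
  case False
  then have "(\<Sum>i\<in>I. exp (\<beta> \<bullet> y i)) > 0" using assms by (intro sum_pos) auto
  then show ?thesis
    by (auto intro!: derivative_eq_intros
        simp: wmean_def inner_sum_right sum_distrib_left field_simps fun_eq_iff)
qed simp

text \<open>Quotient rule: differentiating the inverse partition sum produces the subtracted product
  of means.\<close>

lemma has_derivative_gibbs_mean:
  fixes y :: "'a \<Rightarrow> 'v::real_inner"
  assumes "finite I"
  shows "(gibbs_mean I y has_derivative gibbs_cov I y \<beta>) (at \<beta>)"
proof (cases "I = {}")
  case False
  define Z where "Z = (\<Sum>i\<in>I. exp (\<beta> \<bullet> y i))"
  have Z: "Z > 0" unfolding Z_def using assms False by (intro sum_pos) auto
  have "((\<lambda>\<beta>. inverse (\<Sum>i\<in>I. exp (\<beta> \<bullet> y i)) *\<^sub>R (\<Sum>i\<in>I. exp (\<beta> \<bullet> y i) *\<^sub>R y i)) has_derivative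
      (\<lambda>v. inverse Z *\<^sub>R (\<Sum>i\<in>I. (exp (\<beta> \<bullet> y i) * (v \<bullet> y i)) *\<^sub>R y i)
         + (- (inverse Z * (\<Sum>i\<in>I. exp (\<beta> \<bullet> y i) * (v \<bullet> y i)) * inverse Z)) *\<^sub>R
            (\<Sum>i\<in>I. exp (\<beta> \<bullet> y i) *\<^sub>R y i))) (at \<beta>)"
    using Z unfolding Z_def
    by (auto intro!: derivative_eq_intros sum.cong simp: fun_eq_iff mult_ac)
  moreover have "gibbs_cov I y \<beta> = (\<lambda>v. inverse Z *\<^sub>R (\<Sum>i\<in>I. (exp (\<beta> \<bullet> y i) * (v \<bullet> y i)) *\<^sub>R y i)
         + (- (inverse Z * (\<Sum>i\<in>I. exp (\<beta> \<bullet> y i) * (v \<bullet> y i)) * inverse Z)) *\<^sub>R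
            (\<Sum>i\<in>I. exp (\<beta> \<bullet> y i) *\<^sub>R y i))"
    by (simp add: gibbs_cov_def wmean_def Z_def[symmetric] fun_eq_iff inner_sum_right mult_ac)
  ultimately show ?thesis by (simp add: wmean_def)
next
  case True
  moreover have "gibbs_cov {} y \<beta> = (\<lambda>v. 0)"
    by (simp add: gibbs_cov_def fun_eq_iff)
  ultimately show ?thesis by simp
qed

text \<open>The constant 6 is 2 + 4. The second moments have an integrand bounded by
  \<open>norm v * H\<^sup>2\<close> and contribute 2. The products of means are compared by changing
  one factor at a time, and each of the two changes contributes 2.\<close>

lemma norm_gibbs_cov_diff_le:
  fixes y :: "'a \<Rightarrow> 'v::real_inner"
  assumes fin: "finite I" and sub: "D \<subseteq> I"
    and y: "\<And>i. i \<in> I \<Longrightarrow> norm (y i) \<le> H" and H: "0 \<le> H"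
    and q: "(\<Sum>i\<in>I. exp (\<beta> \<bullet> y i)) - (\<Sum>i\<in>D. exp (\<beta> \<bullet> y i)) \<le> q * (\<Sum>i\<in>I. exp (\<beta> \<bullet> y i))" "0 \<le> q"
  shows "norm (gibbs_cov D y \<beta> v - gibbs_cov I y \<beta> v) \<le> 6 * H\<^sup>2 * q * norm v"
proof -
  let ?w = "\<lambda>i. exp (\<beta> \<bullet> y i)"
  let ?h = "\<lambda>i. (v \<bullet> y i) *\<^sub>R y i"
  define a b where "a = gibbs_mean D y \<beta>" and "b = gibbs_mean I y \<beta>"
  have h: "norm (?h i) \<le> norm v * H\<^sup>2" if "i \<in> I" for i
  proof -
    have "norm (?h i) \<le> (norm v * norm (y i)) * norm (y i)"
      using Cauchy_Schwarz_ineq2[of v "y i"] by (simp add: mult_right_mono)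
    also have "\<dots> \<le> (norm v * H) * H"
      using y[OF that] H by (intro mult_mono) auto
    finally show ?thesis by (simp add: power2_eq_square)
  qed
  have 1: "norm (wmean D ?w ?h - wmean I ?w ?h) \<le> 2 * (norm v * H\<^sup>2) * q"
    using h q H by (intro norm_wmean_diff_le[OF fin sub]) auto
  have ab: "norm (a - b) \<le> 2 * H * q"
    unfolding a_def b_def using y q H by (intro norm_wmean_diff_le[OF fin sub]) auto
  have a: "norm a \<le> H" and b: "norm b \<le> H"
    unfolding a_def b_def using y sub H by (auto intro!: norm_wmean_le)
  have "(v \<bullet> a) *\<^sub>R a - (v \<bullet> b) *\<^sub>R b = (v \<bullet> a) *\<^sub>R (a - b) + (v \<bullet> (a - b)) *\<^sub>R b"
    by (simp add: algebra_simps)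
  also have "norm \<dots> \<le> (norm v * norm a) * norm (a - b) + (norm v * norm (a - b)) * norm b"
    by (rule norm_triangle_le)
       (auto intro!: add_mono mult_right_mono Cauchy_Schwarz_ineq2)
  also have "\<dots> \<le> (norm v * H) * (2 * H * q) + (norm v * (2 * H * q)) * H"
    using a b ab H q by (intro add_mono mult_mono) auto
  finally have 2: "norm ((v \<bullet> a) *\<^sub>R a - (v \<bullet> b) *\<^sub>R b) \<le> 4 * H\<^sup>2 * q * norm v"
    by (simp add: power2_eq_square)
  have "gibbs_cov D y \<beta> v - gibbs_cov I y \<beta> v =
      (wmean D ?w ?h - wmean I ?w ?h) - ((v \<bullet> a) *\<^sub>R a - (v \<bullet> b) *\<^sub>R b)"
    by (simp add: gibbs_cov_def a_def b_def)
  also have "norm \<dots> \<le> 2 * (norm v * H\<^sup>2) * q + 4 * H\<^sup>2 * q * norm v"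
    by (rule order_trans[OF norm_triangle_ineq4 add_mono[OF 1 2]])
  finally show ?thesis by (simp add: mult_ac)
qed

section \<open>Tuples with and without repetition\<close>

text \<open>Lists model \<open>L\<close> ordered draws from \<open>A\<close>. Order is kept because
  the sum of product weights over all lists factorises, which a sum over sets of size
  \<open>L\<close> does not.\<close>

definition tuples :: "'j set \<Rightarrow> nat \<Rightarrow> 'j list set" where
  "tuples A L = {xs. set xs \<subseteq> A \<and> length xs = L}"

definition distinct_tuples :: "'j set \<Rightarrow> nat \<Rightarrow> 'j list set" where
  "distinct_tuples A L = {xs \<in> tuples A L. distinct xs}"

lemma finite_tuples: "finite A \<Longrightarrow> finite (tuples A L)"
  unfolding tuples_def by (rule finite_lists_length_eq)

lemma distinct_tuples_subset: "distinct_tuples A L \<subseteq> tuples A L"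
  by (auto simp: distinct_tuples_def)

lemma finite_distinct_tuples: "finite A \<Longrightarrow> finite (distinct_tuples A L)"
  using finite_subset[OF distinct_tuples_subset finite_tuples] .

lemma sum_tuples_0: "(\<Sum>xs\<in>tuples A 0. h xs) = h []"
  and sum_distinct_tuples_0: "(\<Sum>xs\<in>distinct_tuples A 0. h xs) = h []"
proof -
  have "tuples A 0 = {[]}" "distinct_tuples A 0 = {[]}" by (auto simp: tuples_def distinct_tuples_def)
  then show "(\<Sum>xs\<in>tuples A 0. h xs) = h []" "(\<Sum>xs\<in>distinct_tuples A 0. h xs) = h []" by simp_all
qed

lemma sum_tuples_Suc:
  "(\<Sum>xs\<in>tuples A (Suc L). h xs) = (\<Sum>xs\<in>tuples A L. \<Sum>j\<in>A. h (j # xs))"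
proof -
  have inj: "inj_on (\<lambda>p. snd p # fst p) (tuples A L \<times> A)" by (auto simp: inj_on_def)
  show ?thesis
    using lists_length_Suc_eq[of A L]
    by (simp add: tuples_def[symmetric] sum.reindex[OF inj] sum.cartesian_product case_prod_unfold)
qed

lemma sum_distinct_tuples_Suc:
  assumes "finite A"
  shows "(\<Sum>xs\<in>distinct_tuples A (Suc L). h xs) =
    (\<Sum>xs\<in>distinct_tuples A L. \<Sum>j\<in>A - set xs. h (j # xs))"
proof -
  have inj: "inj_on (\<lambda>p. snd p # fst p) (SIGMA xs:distinct_tuples A L. A - set xs)"
    by (auto simp: inj_on_def)
  have "distinct_tuples A (Suc L) = (\<lambda>(xs, j). j # xs) ` (SIGMA xs:distinct_tuples A L. A - set xs)"
    by (auto simp: distinct_tuples_def tuples_def length_Suc_conv image_iff)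
  then show ?thesis
    using assms by (simp add: sum.reindex[OF inj] sum.Sigma finite_distinct_tuples case_prod_unfold)
qed

text \<open>Each \<open>J\<close> of size \<open>L\<close> is the set of exactly
  \<open>fact L\<close> repetition-free lists, its permutations. This is the passage from ordered
  draws to receiver sets.\<close>

lemma sum_distinct_tuples_set:
  fixes h :: "'j set \<Rightarrow> 'v::real_vector"
  assumes "finite A"
  shows "(\<Sum>xs\<in>distinct_tuples A L. h (set xs)) = (fact L :: real) *\<^sub>R (\<Sum>J | J \<subseteq> A \<and> card J = L. h J)"
proof -
  let ?T = "{J. J \<subseteq> A \<and> card J = L}"
  have finT: "finite ?T" using assms by simp
  have "set ` distinct_tuples A L \<subseteq> ?T"
    by (auto simp: distinct_tuples_def tuples_def distinct_card)
  then have "(\<Sum>xs\<in>distinct_tuples A L. h (set xs)) =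
      (\<Sum>J\<in>?T. \<Sum>xs | xs \<in> distinct_tuples A L \<and> set xs = J. h (set xs))"
    using sum.group[OF finite_distinct_tuples[OF assms] finT, of set L "\<lambda>xs. h (set xs)"] by simp
  also have "\<dots> = (\<Sum>J\<in>?T. (fact L :: real) *\<^sub>R h J)"
  proof (rule sum.cong[OF refl])
    fix J assume J: "J \<in> ?T"
    then have "finite J" using assms finite_subset by auto
    have "{xs. xs \<in> distinct_tuples A L \<and> set xs = J} = permutations_of_set J"
      using J by (auto simp: distinct_tuples_def tuples_def permutations_of_set_def distinct_card)
    then have "(\<Sum>xs | xs \<in> distinct_tuples A L \<and> set xs = J. h (set xs)) =
        (\<Sum>xs\<in>permutations_of_set J. h J)"
      by (intro sum.cong) (auto simp: permutations_of_set_def)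
    also have "\<dots> = (fact L :: real) *\<^sub>R h J"
      using J \<open>finite J\<close> by (simp add: sum_constant_scaleR)
    finally show "(\<Sum>xs | xs \<in> distinct_tuples A L \<and> set xs = J. h (set xs)) = (fact L :: real) *\<^sub>R h J" .
  qed
  finally show ?thesis by (simp add: scaleR_sum_right)
qed

section \<open>Gibbs means and covariances over tuples\<close>

abbreviation tuple_sum :: "('j \<Rightarrow> 'v) \<Rightarrow> 'j list \<Rightarrow> 'v::real_inner" where
  "tuple_sum x xs \<equiv> sum_list (map x xs)"

lemma norm_tuple_sum_le:
  assumes "\<And>j. j \<in> A \<Longrightarrow> norm (x j) \<le> K" "xs \<in> tuples A L"
  shows "norm (tuple_sum x xs) \<le> real L * K"
proof -
  have "set xs \<subseteq> A \<Longrightarrow> norm (tuple_sum x xs) \<le> real (length xs) * K"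
  proof (induction xs)
    case (Cons j xs)
    then show ?case
      using norm_triangle_ineq[of "x j" "tuple_sum x xs"] assms(1)[of j] by (simp add: algebra_simps)
  qed simp
  then show ?thesis using assms(2) by (simp add: tuples_def)
qed

text \<open>The factor \<open>fact L\<close> appears in numerator and denominator and
  cancels.\<close>

lemma gibbs_mean_distinct_tuples:
  assumes "finite A"
  shows "gibbs_mean (distinct_tuples A L) (tuple_sum x) \<beta> =
    gibbs_mean {J. J \<subseteq> A \<and> card J = L} (sum x) \<beta>"
proof -
  have eq: "tuple_sum x xs = sum x (set xs)" if "xs \<in> distinct_tuples A L" for xs
    using that by (simp add: distinct_tuples_def sum_list_distinct_conv_sum_set)
  have "(\<Sum>xs\<in>distinct_tuples A L. exp (\<beta> \<bullet> tuple_sum x xs)) =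
      fact L * (\<Sum>J | J \<subseteq> A \<and> card J = L. exp (\<beta> \<bullet> sum x J))"
    using sum_distinct_tuples_set[OF assms, of "\<lambda>J. exp (\<beta> \<bullet> sum x J)" L] eq by simp
  moreover have "(\<Sum>xs\<in>distinct_tuples A L. exp (\<beta> \<bullet> tuple_sum x xs) *\<^sub>R tuple_sum x xs) =
      (fact L :: real) *\<^sub>R (\<Sum>J | J \<subseteq> A \<and> card J = L. exp (\<beta> \<bullet> sum x J) *\<^sub>R sum x J)"
    using sum_distinct_tuples_set[OF assms, of "\<lambda>J. exp (\<beta> \<bullet> sum x J) *\<^sub>R sum x J" L] eq by simp
  ultimately show ?thesis by (simp add: wmean_def)
qed

text \<open>The weight of a tuple is the product of the weights of its entries, so the draws are
  independent and the partition sum is a power.\<close>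

lemma sum_exp_tuples:
  "(\<Sum>xs\<in>tuples A L. exp (\<beta> \<bullet> tuple_sum x xs)) = (\<Sum>j\<in>A. exp (\<beta> \<bullet> x j)) ^ L"
  by (induction L)
     (simp_all add: sum_tuples_0 sum_tuples_Suc inner_add_right exp_add
        flip: sum_distrib_left sum_distrib_right)

text \<open>The expectation of a sum of \<open>L\<close> independent draws is \<open>L\<close> times
  that of a single draw.\<close>

lemma gibbs_mean_tuples:
  assumes "finite A"
  shows "gibbs_mean (tuples A L) (tuple_sum x) \<beta> = real L *\<^sub>R gibbs_mean A x \<beta>"
proof -
  let ?p = "\<Sum>j\<in>A. exp (\<beta> \<bullet> x j)"
  \<comment> \<open>The numerator has the form of the derivative of \<open>?p ^ L\<close>. The
    truncated \<open>L - 1\<close> is harmless at \<open>L = 0\<close>, where the factor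
    \<open>real L\<close> vanishes.\<close>
  have *: "(\<Sum>xs\<in>tuples A L. exp (\<beta> \<bullet> tuple_sum x xs) *\<^sub>R tuple_sum x xs) =
      (real L * ?p ^ (L - 1)) *\<^sub>R (\<Sum>j\<in>A. exp (\<beta> \<bullet> x j) *\<^sub>R x j)"
  proof (induction L)
    case (Suc L)
    have "(\<Sum>xs\<in>tuples A (Suc L). exp (\<beta> \<bullet> tuple_sum x xs) *\<^sub>R tuple_sum x xs) =
       (\<Sum>xs\<in>tuples A L. exp (\<beta> \<bullet> tuple_sum x xs) *\<^sub>R (\<Sum>j\<in>A. exp (\<beta> \<bullet> x j) *\<^sub>R x j)
          + ?p *\<^sub>R (exp (\<beta> \<bullet> tuple_sum x xs) *\<^sub>R tuple_sum x xs))"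
      unfolding sum_tuples_Suc
    proof (rule sum.cong[OF refl])
      fix xs
      let ?e = "exp (\<beta> \<bullet> tuple_sum x xs)"
      have "(\<Sum>j\<in>A. exp (\<beta> \<bullet> tuple_sum x (j # xs)) *\<^sub>R tuple_sum x (j # xs)) =
          (\<Sum>j\<in>A. ?e *\<^sub>R (exp (\<beta> \<bullet> x j) *\<^sub>R x j) + exp (\<beta> \<bullet> x j) *\<^sub>R (?e *\<^sub>R tuple_sum x xs))"
        by (intro sum.cong) (simp_all add: inner_add_right exp_add scaleR_add_right mult.commute)
      then show "(\<Sum>j\<in>A. exp (\<beta> \<bullet> tuple_sum x (j # xs)) *\<^sub>R tuple_sum x (j # xs)) =
          ?e *\<^sub>R (\<Sum>j\<in>A. exp (\<beta> \<bullet> x j) *\<^sub>R x j) + ?p *\<^sub>R (?e *\<^sub>R tuple_sum x xs)"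
        by (simp only: sum.distrib scaleR_sum_left scaleR_sum_right)
    qed
    also have "\<dots> = (\<Sum>xs\<in>tuples A L. exp (\<beta> \<bullet> tuple_sum x xs)) *\<^sub>R (\<Sum>j\<in>A. exp (\<beta> \<bullet> x j) *\<^sub>R x j)
          + ?p *\<^sub>R (\<Sum>xs\<in>tuples A L. exp (\<beta> \<bullet> tuple_sum x xs) *\<^sub>R tuple_sum x xs)"
      unfolding sum.distrib scaleR_sum_left[of _ "tuples A L"] scaleR_sum_right[of ?p] ..
    also have "\<dots> = (?p ^ L + ?p * (real L * ?p ^ (L - 1))) *\<^sub>R (\<Sum>j\<in>A. exp (\<beta> \<bullet> x j) *\<^sub>R x j)"
      by (simp add: Suc sum_exp_tuples algebra_simps)
    also have "?p ^ L + ?p * (real L * ?p ^ (L - 1)) = real (Suc L) * ?p ^ (Suc L - 1)"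
      by (cases L) (auto simp: algebra_simps)
    finally show ?case .
  qed (simp add: sum_tuples_0)
  show ?thesis
  proof (cases "A = {}")
    case False
    then have "?p > 0" using assms by (intro sum_pos) auto
    then have "inverse (?p ^ L) * (real L * ?p ^ (L - 1)) = real L * inverse ?p"
      by (cases L) (simp_all add: field_simps)
    then show ?thesis
      unfolding wmean_def sum_exp_tuples * by simp
  next
    case True
    then show ?thesis using * by (cases L) (auto simp: wmean_def)
  qed
qed

text \<open>The covariances are derivatives in \<beta> of the means, so the identity follows from
  the one for means by uniqueness of derivatives, without computing second moments.\<close>

lemma gibbs_cov_distinct_tuples:
  fixes x :: "'j \<Rightarrow> 'v::real_inner"
  assumes "finite A"
  shows "gibbs_cov (distinct_tuples A L) (tuple_sum x) \<beta> =
    gibbs_cov {J. J \<subseteq> A \<and> card J = L} (sum x) \<beta>"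
proof (rule has_derivative_unique)
  show "(gibbs_mean (distinct_tuples A L) (tuple_sum x) has_derivative
      gibbs_cov (distinct_tuples A L) (tuple_sum x) \<beta>) (at \<beta>)"
    by (intro has_derivative_gibbs_mean finite_distinct_tuples assms)
  show "(gibbs_mean (distinct_tuples A L) (tuple_sum x) has_derivative
      gibbs_cov {J. J \<subseteq> A \<and> card J = L} (sum x) \<beta>) (at \<beta>)"
    unfolding gibbs_mean_distinct_tuples[OF assms]
    by (intro has_derivative_gibbs_mean) (use assms in auto)
qed

text \<open>Covariances of independent draws add up; again this is read off by differentiating the
  identity for means.\<close>

lemma gibbs_cov_tuples:
  fixes x :: "'j \<Rightarrow> 'v::real_inner"
  assumes "finite A"
  shows "gibbs_cov (tuples A L) (tuple_sum x) \<beta> = (\<lambda>v. real L *\<^sub>R gibbs_cov A x \<beta> v)"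
proof (rule has_derivative_unique)
  show "(gibbs_mean (tuples A L) (tuple_sum x) has_derivative
      gibbs_cov (tuples A L) (tuple_sum x) \<beta>) (at \<beta>)"
    by (intro has_derivative_gibbs_mean finite_tuples assms)
  show "(gibbs_mean (tuples A L) (tuple_sum x) has_derivative
      (\<lambda>v. real L *\<^sub>R gibbs_cov A x \<beta> v)) (at \<beta>)"
    unfolding gibbs_mean_tuples[OF assms]
    by (intro has_derivative_scaleR_right has_derivative_gibbs_mean assms)
qed

text \<open>A birthday bound. Given \<open>L\<close> distinct draws, the next one repeats with
  probability at most \<open>L * exp b / p\<close>, and \<open>p\<close> is at least
  \<open>card A * exp (- b)\<close>. Summing over the draws gives at most
  \<open>L ^ 2 * exp (2 * b) / card A\<close>. The indicator records that fewer than two draws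
  cannot repeat.\<close>

lemma sum_exp_distinct_tuples_ge:
  fixes x :: "'j \<Rightarrow> 'v::real_inner"
  assumes fin: "finite A" and bd: "\<And>j. j \<in> A \<Longrightarrow> \<bar>\<beta> \<bullet> x j\<bar> \<le> b"
  defines "p \<equiv> \<Sum>j\<in>A. exp (\<beta> \<bullet> x j)"
  shows "(1 - real L ^ 2 * exp (2 * b) * (of_bool (L > 1) / real (card A))) * p ^ L
    \<le> (\<Sum>xs\<in>distinct_tuples A L. exp (\<beta> \<bullet> tuple_sum x xs))"
proof (cases "A = {}")
  \<comment> \<open>Division by \<open>card A = 0\<close> gives 0, so the claim is that
    \<open>p ^ L\<close> is at most the sum. Both are 1 for \<open>L = 0\<close>; for larger
    \<open>L\<close> the left side is 0.\<close>
  case True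
  then show ?thesis
    by (cases L) (auto simp: p_def sum_distinct_tuples_0 intro!: sum_nonneg)
next
  case False
  define N where "N = real (card A)"
  define r where "r L = (\<Sum>xs\<in>distinct_tuples A L. exp (\<beta> \<bullet> tuple_sum x xs))" for L
  have N: "N > 0" using False fin by (auto simp: N_def card_gt_0_iff)
  have p: "p \<ge> N * exp (- b)"
  proof -
    have "exp (- b) \<le> exp (\<beta> \<bullet> x j)" if "j \<in> A" for j using bd[OF that] by simp
    then show ?thesis
      using sum_bounded_below[of A "exp (- b)" "\<lambda>j. exp (\<beta> \<bullet> x j)"] by (simp add: p_def N_def)
  qed
  moreover have "N * exp (- b) > 0" using N by simp
  ultimately have p0: "p > 0" by linarith
  have r_le: "r L \<le> p ^ L" for L
    unfolding r_def p_def sum_exp_tuples[symmetric]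
    by (intro sum_mono2 finite_tuples fin distinct_tuples_subset) auto
  have eb: "exp b \<le> exp (2 * b) / N * p"
  proof -
    have "exp b = exp (2 * b) / N * (N * exp (- b))" using N by (simp flip: exp_add)
    also have "\<dots> \<le> exp (2 * b) / N * p" using p N by (intro mult_left_mono) auto
    finally show ?thesis .
  qed
  \<comment> \<open>Excluding the \<open>L\<close> receivers already drawn removes weight at most
    \<open>L * exp b\<close>. By \<open>eb\<close> and \<open>r_le\<close> the total loss is at most
    the subtracted term.\<close>
  have step: "r (Suc L) \<ge> r L * p - real L * (exp (2 * b) / N) * p ^ Suc L" for L
  proof -
    have "r L * p - real L * (exp (2 * b) / N) * p ^ Suc L
        \<le> r L * p - real L * exp b * r L"
    proof -
      have "exp b * r L \<le> (exp (2 * b) / N * p) * p ^ L"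
        using eb r_le[of L] N p0 by (intro mult_mono) (auto simp: r_def intro!: sum_nonneg)
      from mult_left_mono[OF this, of "real L"] show ?thesis by (simp add: mult_ac)
    qed
    also have "\<dots> = (\<Sum>xs\<in>distinct_tuples A L. exp (\<beta> \<bullet> tuple_sum x xs) * (p - real L * exp b))"
      unfolding sum_distrib_right[symmetric] by (simp add: r_def algebra_simps)
    also have "\<dots> \<le> (\<Sum>xs\<in>distinct_tuples A L. exp (\<beta> \<bullet> tuple_sum x xs) *
        (\<Sum>j\<in>A - set xs. exp (\<beta> \<bullet> x j)))"
    proof (intro sum_mono mult_left_mono)
      fix xs assume xs: "xs \<in> distinct_tuples A L"
      then have sub: "set xs \<subseteq> A" and card: "card (set xs) = L"
        by (auto simp: distinct_tuples_def tuples_def distinct_card)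
      have "(\<Sum>j\<in>set xs. exp (\<beta> \<bullet> x j)) \<le> of_nat (card (set xs)) * exp b"
        using sub bd by (intro sum_bounded_above) (auto simp: abs_le_iff)
      then show "p - real L * exp b \<le> (\<Sum>j\<in>A - set xs. exp (\<beta> \<bullet> x j))"
        using card by (simp add: p_def sum_diff[OF fin sub])
    qed simp
    also have "\<dots> = r (Suc L)"
      by (simp add: r_def sum_distinct_tuples_Suc[OF fin] sum_distrib_left inner_add_right exp_add mult_ac)
    finally show ?thesis .
  qed
  have "(1 - real L ^ 2 * exp (2 * b) * (of_bool (L > 1) / N)) * p ^ L \<le> r L"
  proof (induction L)
    case (Suc L)
    let ?c = "exp (2 * b) / N"
    have c: "?c \<ge> 0" using N by simp
    \<comment> \<open>For positive \<open>L\<close> the new loss is absorbed by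
      \<open>(L + 1)^2 \<ge> L^2 + L\<close>; for \<open>L = 0\<close> both corrections are 0, and
      this keeps the indicator valid.\<close>
    have "(1 - real (Suc L) ^ 2 * exp (2 * b) * (of_bool (Suc L > 1) / N)) \<le>
        (1 - real L ^ 2 * exp (2 * b) * (of_bool (L > 1) / N)) - real L * ?c"
    proof (cases "L = 0")
      case False
      have "real L ^ 2 * exp (2 * b) * (of_bool (L > 1) / N) \<le> real L ^ 2 * ?c"
        using N by auto
      moreover have "real (Suc L) ^ 2 * ?c \<ge> real L ^ 2 * ?c + real L * ?c"
        unfolding distrib_right[symmetric]
        using c by (intro mult_right_mono) (auto simp: power2_eq_square algebra_simps)
      ultimately show ?thesis using False by simp
    qed simp
    then have "(1 - real (Suc L) ^ 2 * exp (2 * b) * (of_bool (Suc L > 1) / N)) * p ^ Suc L \<le>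
        ((1 - real L ^ 2 * exp (2 * b) * (of_bool (L > 1) / N)) - real L * ?c) * p ^ Suc L"
      using p0 by (intro mult_right_mono) auto
    also have "\<dots> = ((1 - real L ^ 2 * exp (2 * b) * (of_bool (L > 1) / N)) * p ^ L) * p
        - real L * ?c * p ^ Suc L"
      by (simp add: algebra_simps)
    also have "\<dots> \<le> r L * p - real L * ?c * p ^ Suc L"
      using Suc p0 by (intro diff_right_mono mult_right_mono) auto
    also have "\<dots> \<le> r (Suc L)" by (rule step)
    finally show ?case .
  qed (simp add: r_def sum_distinct_tuples_0)
  then show ?thesis by (simp add: r_def N_def)
qed

text \<open>The general comparison is applied to all tuples and to the repetition-free ones, with
  \<open>H = L * K\<close> as the bound on tuple sums. The weight bound \<open>b = B * K\<close>
  comes from Cauchy-Schwarz.\<close>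

lemma
  fixes x :: "'j \<Rightarrow> 'v::real_inner" and L :: nat
  assumes fin: "finite A" and x: "\<And>j. norm (x j) \<le> K" and \<beta>: "norm \<beta> \<le> B"
  defines "q \<equiv> real L ^ 2 * exp (2 * (B * K)) * (of_bool (L > 1) / real (card A))"
  shows norm_gibbs_mean_subsets_diff_le:
    "norm (gibbs_mean {J. J \<subseteq> A \<and> card J = L} (sum x) \<beta> - real L *\<^sub>R gibbs_mean A x \<beta>)
      \<le> 2 * (real L * K) * q" (is ?mean)
  and norm_gibbs_cov_subsets_diff_le:
    "norm (gibbs_cov {J. J \<subseteq> A \<and> card J = L} (sum x) \<beta> v - real L *\<^sub>R gibbs_cov A x \<beta> v)
      \<le> 6 * (real L * K)\<^sup>2 * q * norm v" (is ?cov)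
proof -
  have K: "K \<ge> 0" using x norm_ge_zero order_trans by blast
  have inner: "\<bar>\<beta> \<bullet> x j\<bar> \<le> B * K" for j
  proof -
    have "\<bar>\<beta> \<bullet> x j\<bar> \<le> norm \<beta> * norm (x j)" by (rule Cauchy_Schwarz_ineq2)
    also have "\<dots> \<le> B * K" using x[of j] \<beta> order_trans[OF norm_ge_zero \<beta>] by (intro mult_mono) auto
    finally show ?thesis .
  qed
  have q: "(\<Sum>xs\<in>tuples A L. exp (\<beta> \<bullet> tuple_sum x xs)) -
      (\<Sum>xs\<in>distinct_tuples A L. exp (\<beta> \<bullet> tuple_sum x xs))
      \<le> q * (\<Sum>xs\<in>tuples A L. exp (\<beta> \<bullet> tuple_sum x xs))"
    using sum_exp_distinct_tuples_ge[OF fin inner, of L]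
    by (simp add: sum_exp_tuples q_def algebra_simps)
  have q0: "q \<ge> 0" by (simp add: q_def)
  have y: "norm (tuple_sum x xs) \<le> real L * K" if "xs \<in> tuples A L" for xs
    using norm_tuple_sum_le[OF _ that] x by blast
  have LK: "0 \<le> real L * K" using K by simp
  show ?mean
    unfolding gibbs_mean_distinct_tuples[OF fin, symmetric] gibbs_mean_tuples[OF fin, symmetric]
    by (rule norm_wmean_diff_le[OF finite_tuples[OF fin] distinct_tuples_subset exp_gt_zero y LK q q0])
  show ?cov
    using norm_gibbs_cov_diff_le[OF finite_tuples[OF fin] distinct_tuples_subset y LK q q0, of v]
    by (simp add: gibbs_cov_distinct_tuples[OF fin] gibbs_cov_tuples[OF fin])
qed

section \<open>Gradients and Hessians of the log partial likelihoods\<close>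

lemma grad_eqI:
  assumes "(f has_derivative (\<lambda>v. v \<bullet> g)) (at \<beta>)"
  shows "grad f \<beta> = g"
  by (simp add: grad_def frechet_derivative_at[OF assms, symmetric] inner_axis' vec_eq_iff)

text \<open>The action on vectors is all that an operator norm needs.\<close>

lemma hessian_mult_vec:
  fixes f :: "real ^ 'p \<Rightarrow> real"
  assumes "(grad f has_derivative D) (at \<beta>)"
  shows "hessian f \<beta> *v v = D v"
proof -
  have "(grad f has_derivative (\<lambda>v. hessian f \<beta> *v v)) (at \<beta>)"
    unfolding hessian_def using assms by (simp add: differentiableI flip: jacobian_works)
  from has_derivative_unique[OF this assms] show ?thesis by (rule fun_cong)
qed

text \<open>One formula serves both likelihoods: \<open>c m = 1\<close> with receiver sets as index
  family, or \<open>c m\<close> the number of receivers with single receivers as index family. The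
  linear term is common to both and disappears in the difference.\<close>

lemma
  fixes x :: "'m \<Rightarrow> 'j \<Rightarrow> real ^ 'p" and y :: "'m \<Rightarrow> 'a \<Rightarrow> real ^ 'p"
    and R :: "'m \<Rightarrow> 'j set" and c :: "'m \<Rightarrow> real"
  assumes "\<And>m. m \<in> I \<Longrightarrow> finite (B m)"
  defines "f \<equiv> (\<lambda>\<beta>. \<Sum>m\<in>I. (\<Sum>j\<in>R m. \<beta> \<bullet> x m j) - c m * ln (\<Sum>i\<in>B m. exp (\<beta> \<bullet> y m i)))"
  shows grad_sum_ln_sum_exp:
    "grad f \<beta> = (\<Sum>m\<in>I. sum (x m) (R m) - c m *\<^sub>R gibbs_mean (B m) (y m) \<beta>)" (is ?grad)
  and hessian_sum_ln_sum_exp: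
    "hessian f \<beta> *v v = - (\<Sum>m\<in>I. c m *\<^sub>R gibbs_cov (B m) (y m) \<beta> v)" (is ?hess)
proof -
  \<comment> \<open>Stated for every \<beta>, because the Hessian differentiates
    \<open>grad f\<close> as a function.\<close>
  have g: "grad f \<beta> = (\<Sum>m\<in>I. sum (x m) (R m) - c m *\<^sub>R gibbs_mean (B m) (y m) \<beta>)" for \<beta>
  proof (rule grad_eqI)
    have "(f has_derivative (\<lambda>v. \<Sum>m\<in>I. (\<Sum>j\<in>R m. v \<bullet> x m j) -
        c m * (v \<bullet> gibbs_mean (B m) (y m) \<beta>))) (at \<beta>)"
      unfolding f_def
      by (intro has_derivative_sum has_derivative_diff has_derivative_mult_right
          has_derivative_inner_left has_derivative_ident has_derivative_ln_sum_exp assms)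
    then show "(f has_derivative (\<lambda>v. v \<bullet>
        (\<Sum>m\<in>I. sum (x m) (R m) - c m *\<^sub>R gibbs_mean (B m) (y m) \<beta>))) (at \<beta>)"
      by (simp add: inner_sum_right inner_diff_right)
  qed
  show ?grad by (rule g)
  have "(grad f has_derivative (\<lambda>v. \<Sum>m\<in>I. 0 - c m *\<^sub>R gibbs_cov (B m) (y m) \<beta> v)) (at \<beta>)"
    unfolding g[abs_def]
    by (intro has_derivative_sum has_derivative_diff has_derivative_scaleR_right
        has_derivative_const has_derivative_gibbs_mean assms)
  from hessian_mult_vec[OF this] show ?hess by (simp add: sum_negf)
qed

text \<open>The bounds for single observations increase with the number of receivers, so that number
  is replaced by \<open>L\<close> before summing. The resulting constant does not depend on
  \<open>n\<close>, on the path or on the particular \<beta>.\<close>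

lemma
  fixes x :: "real \<Rightarrow> 'w \<Rightarrow> 'i \<Rightarrow> 'j \<Rightarrow> real ^ 'p"
  assumes fin: "\<And>t i. 0 \<le> t \<Longrightarrow> finite (A t \<omega> i)"
    and x: "\<And>t i j. 0 \<le> t \<Longrightarrow> norm (x t \<omega> i j) \<le> K"
    and R: "\<And>m. 1 \<le> m \<Longrightarrow> real (card (R m \<omega>)) \<le> L"
    and T: "\<And>m. 1 \<le> m \<Longrightarrow> 0 \<le> T m \<omega>"
    and \<beta>: "norm \<beta> \<le> B"
  shows norm_grad_log_PL_diff_le:
    "norm (grad (log_PL T S R A x (T n \<omega>) \<omega>) \<beta> - grad (log_PL_approx T S R A x (T n \<omega>) \<omega>) \<beta>)
      \<le> 2 * (L * K) * (L\<^sup>2 * exp (2 * (B * K))) * growth T S R A n \<omega>" (is ?grad)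
  and spectral_norm_hessian_log_PL_diff_le:
    "spectral_norm (hessian (log_PL T S R A x (T n \<omega>) \<omega>) \<beta> -
        hessian (log_PL_approx T S R A x (T n \<omega>) \<omega>) \<beta>)
      \<le> 6 * (L * K)\<^sup>2 * (L\<^sup>2 * exp (2 * (B * K))) * growth T S R A n \<omega>" (is ?hess)
proof -
  \<comment> \<open>On an exceptional path \<open>I\<close> may be infinite; sums over it are then 0
    and the estimates persist.\<close>
  define I where "I = {m. 1 \<le> m \<and> T m \<omega> \<le> T n \<omega>}"
  define A' where "A' m = A (T m \<omega>) \<omega> (S m \<omega>)" for m
  define x' where "x' m = x (T m \<omega>) \<omega> (S m \<omega>)" for m
  define l where "l m = card (R m \<omega>)" for m
  define g where "g m = of_bool (l m > 1) / real (card (A' m))" for m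
  have I: "finite (A' m)" "\<And>j. norm (x' m j) \<le> K" "real (l m) \<le> L" if "m \<in> I" for m
    using that T[of m] fin x R by (auto simp: I_def A'_def x'_def l_def)
  have K: "0 \<le> K" using x[of 0] norm_ge_zero order_trans by blast
  have L: "0 \<le> L" using R[of 1] by (meson of_nat_0_le_iff order_refl order_trans)
  have growth: "growth T S R A n \<omega> = sum g I"
    by (simp add: growth_def g_def I_def A'_def l_def)
  \<comment> \<open>The explicit factor 1 brings the expression into the shape with coefficients
    \<open>c m\<close>.\<close>
  have PL: "log_PL T S R A x (T n \<omega>) \<omega> = (\<lambda>\<beta>. \<Sum>m\<in>I. (\<Sum>j\<in>R m \<omega>. \<beta> \<bullet> x' m j) -
      1 * ln (\<Sum>J | J \<subseteq> A' m \<and> card J = l m. exp (\<beta> \<bullet> sum (x' m) J)))"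
    by (simp add: log_PL_def fun_eq_iff I_def A'_def x'_def l_def inner_sum_right)
  have PL': "log_PL_approx T S R A x (T n \<omega>) \<omega> = (\<lambda>\<beta>. \<Sum>m\<in>I. (\<Sum>j\<in>R m \<omega>. \<beta> \<bullet> x' m j) -
      real (l m) * ln (\<Sum>j\<in>A' m. exp (\<beta> \<bullet> x' m j)))"
    by (simp add: log_PL_approx_def fun_eq_iff I_def A'_def x'_def l_def)
  let ?d = "\<lambda>m. gibbs_mean {J. J \<subseteq> A' m \<and> card J = l m} (sum (x' m)) \<beta> -
      real (l m) *\<^sub>R gibbs_mean (A' m) (x' m) \<beta>"
  let ?D = "\<lambda>v m. gibbs_cov {J. J \<subseteq> A' m \<and> card J = l m} (sum (x' m)) \<beta> v -
      real (l m) *\<^sub>R gibbs_cov (A' m) (x' m) \<beta> v"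
  have "grad (log_PL T S R A x (T n \<omega>) \<omega>) \<beta> - grad (log_PL_approx T S R A x (T n \<omega>) \<omega>) \<beta> = - sum ?d I"
  proof -
    have 1: "grad (log_PL T S R A x (T n \<omega>) \<omega>) \<beta> = (\<Sum>m\<in>I. sum (x' m) (R m \<omega>) -
        1 *\<^sub>R gibbs_mean {J. J \<subseteq> A' m \<and> card J = l m} (sum (x' m)) \<beta>)"
      unfolding PL using I(1) by (intro grad_sum_ln_sum_exp) auto
    have 2: "grad (log_PL_approx T S R A x (T n \<omega>) \<omega>) \<beta> = (\<Sum>m\<in>I. sum (x' m) (R m \<omega>) -
        real (l m) *\<^sub>R gibbs_mean (A' m) (x' m) \<beta>)"
      unfolding PL' using I(1) by (intro grad_sum_ln_sum_exp) auto
    show ?thesis unfolding 1 2 by (simp add: sum_subtractf)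
  qed
  moreover have "norm (sum ?d I) \<le> (\<Sum>m\<in>I. 2 * (L * K) * (L\<^sup>2 * exp (2 * (B * K))) * g m)"
  proof (rule sum_norm_le)
    fix m assume m: "m \<in> I"
    have "norm (?d m) \<le> 2 * (real (l m) * K) * (real (l m) ^ 2 * exp (2 * (B * K)) * g m)"
      unfolding g_def using I[OF m] \<beta> by (intro norm_gibbs_mean_subsets_diff_le)
    also have "\<dots> \<le> 2 * (L * K) * (L\<^sup>2 * exp (2 * (B * K)) * g m)"
      using I(3)[OF m] K L by (intro mult_mono power_mono) (auto simp: g_def)
    finally show "norm (?d m) \<le> 2 * (L * K) * (L\<^sup>2 * exp (2 * (B * K))) * g m" by (simp add: mult_ac)
  qed
  ultimately show ?grad by (simp add: growth sum_distrib_left)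
  have "norm (sum (?D v) I) \<le> (\<Sum>m\<in>I. 6 * (L * K)\<^sup>2 * (L\<^sup>2 * exp (2 * (B * K))) * g m * norm v)" for v
  proof (rule sum_norm_le)
    fix m assume m: "m \<in> I"
    have "norm (?D v m) \<le> 6 * (real (l m) * K)\<^sup>2 * (real (l m) ^ 2 * exp (2 * (B * K)) * g m) * norm v"
      unfolding g_def using I[OF m] \<beta> by (intro norm_gibbs_cov_subsets_diff_le)
    also have "\<dots> \<le> 6 * (L * K)\<^sup>2 * (L\<^sup>2 * exp (2 * (B * K)) * g m) * norm v"
      using I(3)[OF m] K L by (intro mult_mono power_mono) (auto simp: g_def)
    finally show "norm (?D v m) \<le> 6 * (L * K)\<^sup>2 * (L\<^sup>2 * exp (2 * (B * K))) * g m * norm v"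
      by (simp add: mult_ac)
  qed
  moreover have "(hessian (log_PL T S R A x (T n \<omega>) \<omega>) \<beta> -
      hessian (log_PL_approx T S R A x (T n \<omega>) \<omega>) \<beta>) *v v = - sum (?D v) I" for v
  proof -
    have 1: "hessian (log_PL T S R A x (T n \<omega>) \<omega>) \<beta> *v v =
        - (\<Sum>m\<in>I. 1 *\<^sub>R gibbs_cov {J. J \<subseteq> A' m \<and> card J = l m} (sum (x' m)) \<beta> v)"
      unfolding PL using I(1) by (intro hessian_sum_ln_sum_exp) auto
    have 2: "hessian (log_PL_approx T S R A x (T n \<omega>) \<omega>) \<beta> *v v =
        - (\<Sum>m\<in>I. real (l m) *\<^sub>R gibbs_cov (A' m) (x' m) \<beta> v)"
      unfolding PL' using I(1) by (intro hessian_sum_ln_sum_exp) auto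
    show ?thesis
      unfolding matrix_vector_mult_diff_rdistrib 1 2 by (simp add: sum_subtractf)
  qed
  ultimately show ?hess
    unfolding spectral_norm_def
    by (intro onorm_le) (simp add: growth sum_distrib_left sum_distrib_right)
qed

section \<open>Stochastic order\<close>

text \<open>Both sets are replaced by measurable supersets of the same outer measure, where
  subadditivity is known.\<close>

lemma outer_measure_of_Un_le:
  assumes "A \<subseteq> space M" "B \<subseteq> space M"
  shows "outer_measure_of M (A \<union> B) \<le> outer_measure_of M A + outer_measure_of M B"
proof -
  obtain E where E: "E \<in> sets M" "A \<subseteq> E" "outer_measure_of M A = emeasure M E"
    using outer_measure_of_attain[OF assms(1)] by blast
  obtain E' where E': "E' \<in> sets M" "B \<subseteq> E'" "outer_measure_of M B = emeasure M E'"
    using outer_measure_of_attain[OF assms(2)] by blast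
  have "outer_measure_of M (A \<union> B) \<le> outer_measure_of M (E \<union> E')"
    using E E' by (intro outer_measure_of_mono) auto
  also have "\<dots> \<le> emeasure M E + emeasure M E'"
    using E E' by (simp add: emeasure_subadditive)
  finally show ?thesis using E E' by simp
qed

text \<open>Reduction to paths: outside two events of outer measure at most
  \<open>\<epsilon> / 2\<close> each and a null set, the deterministic bound applies with
  \<open>C\<close> depending on \<open>K\<close> and \<open>L\<close> only.\<close>

lemma big_O_P_of_bounded_in_prob:
  assumes X: "bounded_in_prob M X" and Y: "bounded_in_prob M Y"
    and P: "AE \<omega> in M. P \<omega>"
    and bound: "\<And>K L. \<exists>C. \<forall>n. \<forall>\<omega>\<in>space M. P \<omega> \<longrightarrow> X \<omega> \<le> ereal K \<longrightarrow> Y \<omega> \<le> ereal L \<longrightarrow>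
      Z n \<omega> \<le> ereal (C * G n \<omega>)"
  shows "big_O_P M Z G"
  unfolding big_O_P_def
proof (intro allI impI)
  fix \<epsilon> :: real assume "\<epsilon> > 0"
  then have \<epsilon>: "\<epsilon> / 2 > 0" by simp
  \<comment> \<open>The event does not involve \<open>n\<close>, so "eventually in \<open>n\<close>"
    reduces to the plain inequality.\<close>
  obtain K where K: "outer_measure_of M {\<omega> \<in> space M. X \<omega> > ereal K} \<le> ennreal (\<epsilon> / 2)"
    using X \<epsilon> unfolding bounded_in_prob_def big_O_P_def by (fastforce simp: eventually_const)
  obtain L where L: "outer_measure_of M {\<omega> \<in> space M. Y \<omega> > ereal L} \<le> ennreal (\<epsilon> / 2)"
    using Y \<epsilon> unfolding bounded_in_prob_def big_O_P_def by (fastforce simp: eventually_const)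
  obtain N where N: "{\<omega> \<in> space M. \<not> P \<omega>} \<subseteq> N" "emeasure M N = 0" "N \<in> sets M"
    using P by (rule AE_E)
  obtain C where C: "\<And>n \<omega>. \<omega> \<in> space M \<Longrightarrow> P \<omega> \<Longrightarrow> X \<omega> \<le> ereal K \<Longrightarrow> Y \<omega> \<le> ereal L \<Longrightarrow>
      Z n \<omega> \<le> ereal (C * G n \<omega>)"
    using bound[of K L] by blast
  have "outer_measure_of M {\<omega> \<in> space M. Z n \<omega> > ereal (C * G n \<omega>)} \<le> ennreal \<epsilon>" for n
  proof -
    let ?X = "{\<omega> \<in> space M. X \<omega> > ereal K}" and ?Y = "{\<omega> \<in> space M. Y \<omega> > ereal L}"
    have "{\<omega> \<in> space M. Z n \<omega> > ereal (C * G n \<omega>)} \<subseteq> (?X \<union> ?Y) \<union> N"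
      using C[of _ n] N(1) by (fastforce simp: not_le[symmetric])
    then have "outer_measure_of M {\<omega> \<in> space M. Z n \<omega> > ereal (C * G n \<omega>)}
        \<le> outer_measure_of M ((?X \<union> ?Y) \<union> N)"
      by (rule outer_measure_of_mono)
    also have "\<dots> \<le> outer_measure_of M (?X \<union> ?Y) + outer_measure_of M N"
      using N(3) sets.sets_into_space by (intro outer_measure_of_Un_le) auto
    also have "\<dots> = outer_measure_of M (?X \<union> ?Y)" using N by simp
    also have "\<dots> \<le> outer_measure_of M ?X + outer_measure_of M ?Y"
      by (intro outer_measure_of_Un_le) auto
    also have "\<dots> \<le> ennreal (\<epsilon> / 2) + ennreal (\<epsilon> / 2)" by (rule add_mono[OF K L])
    also have "\<dots> = ennreal \<epsilon>" using \<epsilon> by (simp flip: ennreal_plus)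
    finally show ?thesis .
  qed
  then show "\<exists>C. \<forall>\<^sub>F n in sequentially.
      outer_measure_of M {\<omega> \<in> space M. Z n \<omega> > ereal (C * G n \<omega>)} \<le> ennreal \<epsilon>"
    by (intro exI[of _ C]) simp
qed

text \<open>Covariates and available receivers are controlled at non-negative times only, so
  interaction times have to be placed there.\<close>

lemma multicast_point_process_times_nonneg:
  assumes "multicast_point_process M F T S R"
  shows "AE \<omega> in M. \<forall>m\<ge>1. 0 \<le> T m \<omega>"
proof -
  have "AE \<omega> in M. 0 < T 1 \<omega> \<and> (\<forall>m\<ge>1. T m \<omega> < T (Suc m) \<omega>)"
    using assms unfolding multicast_point_process_def by (auto elim: eventually_mono)
  then show ?thesis
  proof (rule eventually_mono, intro allI impI)
    fix \<omega> and m :: nat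
    assume *: "0 < T 1 \<omega> \<and> (\<forall>m\<ge>1. T m \<omega> < T (Suc m) \<omega>)" and "1 \<le> m"
    from \<open>1 \<le> m\<close> show "0 \<le> T m \<omega>"
      by (induction m rule: dec_induct) (use * in \<open>force\<close>)+
  qed
qed

text \<open>The pathwise constants involve \<beta> only through a bound on its norm. Hence one
  deterministic neighbourhood works for all \<open>n\<close>, with the supremum over it inside the
  probability.\<close>

theorem theorem3:
  fixes M :: "'w measure" and F :: "real \<Rightarrow> 'w measure"
    and T :: "nat \<Rightarrow> 'w \<Rightarrow> real" and S :: "nat \<Rightarrow> 'w \<Rightarrow> 'i" and R :: "nat \<Rightarrow> 'w \<Rightarrow> 'j set"
    and lbar :: "real \<Rightarrow> 'w \<Rightarrow> 'i \<Rightarrow> nat \<Rightarrow> real"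
    and A :: "real \<Rightarrow> 'w \<Rightarrow> 'i \<Rightarrow> 'j set"
    and x :: "real \<Rightarrow> 'w \<Rightarrow> 'i \<Rightarrow> 'j \<Rightarrow> real ^ 'p"
    and \<beta>\<^sub>0 :: "real ^ 'p"
  assumes "prob_space M"
    and "filtration (space M) F"
    and "\<And>t. subalgebra M (F t)"
    and "\<And>i L. L \<ge> 1 \<Longrightarrow> predictable M F (\<lambda>t \<omega>. lbar t \<omega> i L)"
    and "\<And>i L t \<omega>. L \<ge> 1 \<Longrightarrow> t \<ge> 0 \<Longrightarrow> \<omega> \<in> space M \<Longrightarrow> lbar t \<omega> i L \<ge> 0"
    and "\<And>i j. predictable M F (\<lambda>t \<omega>. indicator (A t \<omega> i) j :: real)"
    and "\<And>i t \<omega>. t \<ge> 0 \<Longrightarrow> \<omega> \<in> space M \<Longrightarrow> finite (A t \<omega> i)"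
    and "\<And>i j. predictable M F (\<lambda>t \<omega>. x t \<omega> i j)"
    and "\<And>i j. locally_bounded_process M F (\<lambda>t \<omega>. x t \<omega> i j)"
    and "multicast_point_process M F T S R"
    and "\<And>i J. finite J \<Longrightarrow> J \<noteq> {} \<Longrightarrow>
           has_intensity M F (interaction_times T S R i J) (multicast_intensity lbar A x \<beta>\<^sub>0 i J)"
    and "bounded_in_prob M (\<lambda>\<omega>. SUP t\<in>{0..}. SUP i. SUP j. ereal (norm (x t \<omega> i j)))"
    and "bounded_in_prob M (\<lambda>\<omega>. SUP m\<in>{1..}. ereal (real (card (R m \<omega>))))"
  shows "\<exists>U. open U \<and> \<beta>\<^sub>0 \<in> U \<and>
    big_O_P M
      (\<lambda>n \<omega>. SUP \<beta>\<in>U. ereal (norm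
         (grad (log_PL T S R A x (T n \<omega>) \<omega>) \<beta> - grad (log_PL_approx T S R A x (T n \<omega>) \<omega>) \<beta>)))
      (growth T S R A) \<and>
    big_O_P M
      (\<lambda>n \<omega>. SUP \<beta>\<in>U. ereal (spectral_norm
         (hessian (log_PL T S R A x (T n \<omega>) \<omega>) \<beta> - hessian (log_PL_approx T S R A x (T n \<omega>) \<omega>) \<beta>)))
      (growth T S R A)"
proof -
  \<comment> \<open>The radius 1 is arbitrary: any bounded open neighbourhood yields a bound
    \<open>?B\<close>.\<close>
  let ?U = "ball \<beta>\<^sub>0 1" and ?B = "norm \<beta>\<^sub>0 + 1"
  let ?X = "\<lambda>\<omega>. SUP t\<in>{0..}. SUP i. SUP j. ereal (norm (x t \<omega> i j))"
  let ?Y = "\<lambda>\<omega>. SUP m\<in>{1..}. ereal (real (card (R m \<omega>)))"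
  let ?P = "\<lambda>\<omega>. \<forall>m\<ge>1. 0 \<le> T m \<omega>"
  have \<beta>: "norm \<beta> \<le> ?B" if "\<beta> \<in> ?U" for \<beta>
    using that norm_triangle_ineq2[of \<beta> \<beta>\<^sub>0] by (simp add: dist_norm norm_minus_commute)
  have X: "norm (x t \<omega> i j) \<le> K" if "?X \<omega> \<le> ereal K" "0 \<le> t" for \<omega> K t i j
    using that by (simp add: SUP_le_iff)
  have Y: "real (card (R m \<omega>)) \<le> L" if "?Y \<omega> \<le> ereal L" "1 \<le> m" for \<omega> L m
    using that by (simp add: SUP_le_iff)
  note bound = big_O_P_of_bounded_in_prob
    [OF assms(12,13) multicast_point_process_times_nonneg[OF assms(10)]]
  have "big_O_P M (\<lambda>n \<omega>. SUP \<beta>\<in>?U. ereal (norm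
         (grad (log_PL T S R A x (T n \<omega>) \<omega>) \<beta> - grad (log_PL_approx T S R A x (T n \<omega>) \<omega>) \<beta>)))
      (growth T S R A)"
  proof (rule bound)
    fix K L :: real
    show "\<exists>C. \<forall>n. \<forall>\<omega>\<in>space M. ?P \<omega> \<longrightarrow> ?X \<omega> \<le> ereal K \<longrightarrow> ?Y \<omega> \<le> ereal L \<longrightarrow>
        (SUP \<beta>\<in>?U. ereal (norm (grad (log_PL T S R A x (T n \<omega>) \<omega>) \<beta> -
          grad (log_PL_approx T S R A x (T n \<omega>) \<omega>) \<beta>))) \<le> ereal (C * growth T S R A n \<omega>)"
      by (intro exI[of _ "2 * (L * K) * (L\<^sup>2 * exp (2 * (?B * K)))"] allI ballI impI SUP_least,
          unfold ereal_less_eq, intro norm_grad_log_PL_diff_le)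
         (use assms(7) X Y \<beta> in blast)+
  qed
  moreover have "big_O_P M (\<lambda>n \<omega>. SUP \<beta>\<in>?U. ereal (spectral_norm
         (hessian (log_PL T S R A x (T n \<omega>) \<omega>) \<beta> - hessian (log_PL_approx T S R A x (T n \<omega>) \<omega>) \<beta>)))
      (growth T S R A)"
  proof (rule bound)
    fix K L :: real
    show "\<exists>C. \<forall>n. \<forall>\<omega>\<in>space M. ?P \<omega> \<longrightarrow> ?X \<omega> \<le> ereal K \<longrightarrow> ?Y \<omega> \<le> ereal L \<longrightarrow>
        (SUP \<beta>\<in>?U. ereal (spectral_norm (hessian (log_PL T S R A x (T n \<omega>) \<omega>) \<beta> -
          hessian (log_PL_approx T S R A x (T n \<omega>) \<omega>) \<beta>))) \<le> ereal (C * growth T S R A n \<omega>)"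
      by (intro exI[of _ "6 * (L * K)\<^sup>2 * (L\<^sup>2 * exp (2 * (?B * K)))"] allI ballI impI SUP_least,
          unfold ereal_less_eq, intro spectral_norm_hessian_log_PL_diff_le)
         (use assms(7) X Y \<beta> in blast)+
  qed
  ultimately show ?thesis by (intro exI[of _ ?U]) auto
qed

end
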